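(* Let $G$ be a graph on $n$ vertices of diameter $d$. Then $c(G)\leq n^t$, where $$t=1-\frac{2}{2\lceil \log{d} \rceil +1}+o(1),$$ $\log$ denotes the logarithm in base $2$, and $o(1)$ denotes a quantity tending to $0$ as $n\to\infty$.
   Context: Cops and Robbers on a graph $G$: first each of $k$ cops chooses an initial vertex, then the robber chooses an initial vertex. Then the players alternate, starting with the cops: in a cops' turn every cop either stays at its vertex or moves to an adjacent vertex, and in the robber's turn the robber stays or moves to an adjacent vertex. Several cops may occupy the same vertex, and both players have full information. The cops win if, whatever the robber does, after some cops' move some cop occupies the robber's vertex. The cop number $c(G)$ is the least $k$ for which the cops win.
   Formalization: The formal theorem assumes diameter d ≥ 3: for d = 0 the logarithm is undefined, for d = 1 complete graphs (c = 1, exponent −1+o(1)) and for d = 2 polarity graphs (c of order √n, exponent 1/3+o(1)) violate the bound. *)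

theory Defs
  imports Complex_Main "Graph_Theory.Graph_Theory"
begin

text \<open>
  The largest distance between two vertices, every arc having length 1; it is \<open>\<infinity>\<close> for a
  disconnected graph.
\<close>
definition graph_diameter :: "'a pair_pre_digraph \<Rightarrow> ereal" where
  "graph_diameter G =
     (SUP u\<in>pverts G. SUP v\<in>pverts G. wf_digraph.\<mu> (with_proj G) (\<lambda>_. 1) u v)"

definition legal_move :: "'a pair_pre_digraph \<Rightarrow> 'a \<Rightarrow> 'a \<Rightarrow> bool" where
  "legal_move G u v \<longleftrightarrow> v = u \<or> (u, v) \<in> parcs G"

text \<open>
  \<open>r 0\<close> is the initial vertex of the robber and \<open>r m\<close> its vertex after its \<open>m\<close>-th move.
\<close>
definition robber_play :: "'a pair_pre_digraph \<Rightarrow> (nat \<Rightarrow> 'a) \<Rightarrow> bool" where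
  "robber_play G r \<longleftrightarrow> r 0 \<in> pverts G \<and> (\<forall>m. legal_move G (r m) (r (Suc m)))"

text \<open>
  A strategy \<open>s\<close> of \<open>k\<close> cops maps the list of all vertices chosen by the robber so far to the
  current positions of the cops, numbered from \<open>0\<close> to \<open>k - 1\<close>: \<open>s []\<close> is the initial placement,
  made before the robber has chosen a vertex, and \<open>s [r 0, \<dots>, r m]\<close> is the position after the
  cops' answer to \<open>r m\<close>, that is, after their move number \<open>m + 1\<close>. The earlier positions of the
  cops are determined by \<open>s\<close> and the robber's vertices, so this is full information.
\<close>
definition cop_strategy ::
    "'a pair_pre_digraph \<Rightarrow> nat \<Rightarrow> ('a list \<Rightarrow> nat \<Rightarrow> 'a) \<Rightarrow> bool" where
  "cop_strategy G k s \<longleftrightarrow>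
     (\<forall>i<k. s [] i \<in> pverts G) \<and>
     (\<forall>r. robber_play G r \<longrightarrow>
        (\<forall>m. \<forall>i<k. legal_move G (s (map r [0..<m]) i) (s (map r [0..<Suc m]) i)))"

definition cops_win :: "'a pair_pre_digraph \<Rightarrow> nat \<Rightarrow> bool" where
  "cops_win G k \<longleftrightarrow>
     (\<exists>s. cop_strategy G k s \<and>
        (\<forall>r. robber_play G r \<longrightarrow> (\<exists>m. \<exists>i<k. s (map r [0..<Suc m]) i = r m)))"

definition cop_number :: "'a pair_pre_digraph \<Rightarrow> nat" where
  "cop_number G = (LEAST k. cops_win G k)"

end

theory Submission
  imports Defs "HOL-Real_Asymp.Real_Asymp"
begin

text \<open>
  Put \<open>L = \<lceil>log 2 d\<rceil> \<ge> 2\<close>, so that any two vertices are at distance at most \<open>2 ^ L\<close>, and let \<open>n = K powr (L + 1/2)\<close>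
  up to a factor \<open>n powr o(1)\<close>. A random team \<open>C\<close> of about \<open>n / K\<close> vertices satisfies
  \<open>|C \<inter> B(S, t)| \<ge> |S|\<close> for all \<open>S\<close> with \<open>|B(S, t)| \<ge> K |S|\<close>, where \<open>B(S, t)\<close> is the set of vertices at
  distance at most \<open>t\<close> from \<open>S\<close>. If the robber is known to be in a set \<open>A\<close> in \<open>t\<close> moves,
  Hall's theorem therefore lets one team occupy \<open>A - S\<close> in time, for some \<open>S \<subseteq> A\<close> with
  \<open>|B(S, t + 1)| \<le> K |S|\<close>; a surviving robber is in \<open>B(S, t + 1)\<close> at time \<open>2 t + 1\<close>. So a robber with \<open>\<Delta>\<close>
  options for his next move is confined to \<open>K ^ i * \<Delta>\<close> vertices at time \<open>2 ^ (i + 1) - 1\<close>, and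
  he is lost if \<open>K ^ L * \<Delta> < n\<close>, because \<open>B(S, 2 ^ L)\<close> is everything.

  It remains to reduce \<open>\<Delta>\<close> from \<open>n\<close> to below \<open>K powr (1/2)\<close>. Let \<open>F\<close> be the set of size \<open>K ^ (L - 1) * \<Delta>\<close> in
  which the robber is at time \<open>t = 2 ^ L - 1\<close>, and greedily choose \<open>D\<close> with \<open>|D| \<le> |F| / q\<close> such that no vertex
  has more than \<open>q\<close> neighbours in \<open>F\<close> outside \<open>N[D]\<close>. A team can reach \<open>D - T\<close> in \<open>t\<close> moves, where
  \<open>|B(T, t)| \<le> K |D|\<close>. Either the robber moves to one of at most \<open>q\<close> undominated vertices, or he enters \<open>N[T]\<close> and is in
  \<open>B(T, t)\<close> at time \<open>2 t - 1 \<ge> 2 ^ L\<close> (this needs \<open>L \<ge> 2\<close>); by then \<open>n / K\<close> cops can be anywhere, and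
  greedy domination of \<open>B(T, t)\<close> again leaves him only \<open>q\<close> options. Both work as soon as
  \<open>q\<^sup>2 \<ge> K ^ (L + 1) * \<Delta> / n\<close>, and iterating \<open>\<Delta> \<mapsto> q\<close> brings \<open>\<Delta>\<close> down to \<open>K ^ (L + 1) / n = K powr (1/2)\<close> in
  boundedly many rounds.
\<close>

section \<open>Matchings and hitting sets\<close>

text \<open>Hall's theorem by the Halmos-Vaughan induction. A nonempty proper subset
  \<open>Y\<close> with exactly \<open>card Y\<close> neighbours is matched on its own, and the rest
  outside those neighbours. Without such a \<open>Y\<close>, every nonempty proper subset has a
  neighbour to spare, so an arbitrary pair may be matched first.\<close>

lemma marriage:
  assumes "finite X" "\<And>x. x \<in> X \<Longrightarrow> finite (N x)"
    and "\<And>Y. Y \<subseteq> X \<Longrightarrow> card Y \<le> card (\<Union>(N ` Y))"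
  shows "\<exists>f. inj_on f X \<and> (\<forall>x\<in>X. f x \<in> N x)"
  using assms
proof (induction "card X" arbitrary: X N rule: less_induct)
  case less
  note fin = less.prems(1) and finN = less.prems(2) and hall = less.prems(3)
  show ?case
  proof (cases "X = {}")
    case True
    then show ?thesis by simp
  next
    case False
    show ?thesis
    proof (cases "\<exists>Y. Y \<subset> X \<and> Y \<noteq> {} \<and> card Y = card (\<Union>(N ` Y))")
      case True
      then obtain Y where Y: "Y \<subset> X" "Y \<noteq> {}" "card Y = card (\<Union>(N ` Y))" by blast
      have finY: "finite Y" using Y fin by (meson finite_subset psubset_imp_subset)
      have finUY: "finite (\<Union>(N ` Y))" using finY finN Y by auto
      have "card Y < card X" using Y(1) fin by (rule psubset_card_mono[rotated])
      then have "\<exists>f. inj_on f Y \<and> (\<forall>x\<in>Y. f x \<in> N x)"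
        by (rule less.hyps) (use finY finN hall Y in auto)
      then obtain f where f: "inj_on f Y" "\<forall>x\<in>Y. f x \<in> N x" by blast
      have "card (X - Y) < card X"
        using Y fin by (intro psubset_card_mono) auto
      moreover have "card Z \<le> card (\<Union>((\<lambda>z. N z - \<Union>(N ` Y)) ` Z))" if Z: "Z \<subseteq> X - Y" for Z
      proof -
        have finZ: "finite Z" using Z fin by (meson finite_Diff finite_subset)
        have "card Y + card Z = card (Y \<union> Z)"
          using Z finY finZ by (subst card_Un_disjoint) auto
        also have "\<dots> \<le> card (\<Union>(N ` (Y \<union> Z)))" by (rule hall) (use Z Y in auto)
        finally have "card Z \<le> card (\<Union>(N ` (Y \<union> Z))) - card (\<Union>(N ` Y))"
          using Y(3) by simp
        also have "\<dots> = card (\<Union>(N ` (Y \<union> Z)) - \<Union>(N ` Y))"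
          using finUY by (subst card_Diff_subset) auto
        also have "\<Union>(N ` (Y \<union> Z)) - \<Union>(N ` Y) = \<Union>((\<lambda>z. N z - \<Union>(N ` Y)) ` Z)"
          by auto
        finally show ?thesis .
      qed
      ultimately have "\<exists>g. inj_on g (X - Y) \<and> (\<forall>z\<in>X - Y. g z \<in> N z - \<Union>(N ` Y))"
        by (intro less.hyps) (use fin finN in auto)
      then obtain g where g: "inj_on g (X - Y)" "\<forall>z\<in>X - Y. g z \<in> N z - \<Union>(N ` Y)" by blast
      define h where "h x = (if x \<in> Y then f x else g x)" for x
      have "inj_on h X"
      proof (rule inj_onI)
        fix x y assume "x \<in> X" "y \<in> X" "h x = h y"
        then show "x = y"
          using f g inj_onD[OF f(1), of x y] inj_onD[OF g(1), of x y] unfolding h_def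
          by (cases "x \<in> Y"; cases "y \<in> Y"; simp) (metis DiffD2 DiffI UN_I)+
      qed
      moreover have "\<forall>x\<in>X. h x \<in> N x" using f g by (auto simp: h_def)
      ultimately show ?thesis by blast
    next
      case tight: False
      obtain x where x: "x \<in> X" using False by blast
      have "card {x} \<le> card (\<Union>(N ` {x}))" using hall x by blast
      then obtain a where a: "a \<in> N x" by fastforce
      have "card (X - {x}) < card X" using x fin by (intro psubset_card_mono) auto
      moreover have "card Y \<le> card (\<Union>((\<lambda>y. N y - {a}) ` Y))" if Y: "Y \<subseteq> X - {x}" for Y
      proof (cases "Y = {}")
        case False
        have finU: "finite (\<Union>(N ` Y))"
          using Y fin finN by (intro finite_UN_I) (auto intro: finite_subset)
        have "card Y \<le> card (\<Union>(N ` Y))" "card Y \<noteq> card (\<Union>(N ` Y))"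
          using hall tight Y x False by blast+
        then have "card Y \<le> card (\<Union>(N ` Y)) - 1" by simp
        also have "\<dots> \<le> card (\<Union>(N ` Y) - {a})"
          using finU by (simp add: card_Diff_singleton_if)
        also have "\<Union>(N ` Y) - {a} = \<Union>((\<lambda>y. N y - {a}) ` Y)" by auto
        finally show ?thesis .
      qed simp
      ultimately have "\<exists>g. inj_on g (X - {x}) \<and> (\<forall>y\<in>X - {x}. g y \<in> N y - {a})"
        by (intro less.hyps) (use fin finN in auto)
      then obtain g where g: "inj_on g (X - {x})" "\<forall>y\<in>X - {x}. g y \<in> N y - {a}" by blast
      have "inj_on (g(x := a)) X"
        using g unfolding inj_on_def by auto
      moreover have "\<forall>y\<in>X. (g(x := a)) y \<in> N y" using g a by auto
      ultimately show ?thesis by blast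
    qed
  qed
qed

text \<open>Derandomised union bound: the summand is the probability that \<open>M\<close> independent uniform
  points of \<open>V\<close> all miss \<open>U j\<close>.\<close>
lemma hitting_set:
  fixes U :: "'i \<Rightarrow> 'a set"
  assumes "finite V" "V \<noteq> {}" "finite J" "\<And>j. j \<in> J \<Longrightarrow> U j \<subseteq> V"
    and "(\<Sum>j\<in>J. (1 - real (card (U j)) / real (card V)) ^ M) < 1"
  shows "\<exists>C\<subseteq>V. card C \<le> M \<and> (\<forall>j\<in>J. C \<inter> U j \<noteq> {})"
  using assms(3-5)
proof (induction M arbitrary: J)
  case 0
  then have "J = {}" by simp
  then show ?case by (intro exI[of _ "{}"]) auto
next
  case (Suc M)
  define p where "p j = 1 - real (card (U j)) / real (card V)" for j
  have n: "card V > 0" using assms(1,2) by (simp add: card_gt_0_iff)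
  \<comment> \<open>Averaged over \<open>v \<in> V\<close>, the sum that remains after
    \<open>v\<close> joins \<open>C\<close> is the original sum, so some \<open>v\<close> keeps it
    below 1.\<close>
  have "(\<Sum>v\<in>V. \<Sum>j | j \<in> J \<and> v \<notin> U j. p j ^ M) = (\<Sum>j\<in>J. \<Sum>v | v \<in> V \<and> v \<notin> U j. p j ^ M)"
    using assms(1) Suc.prems(1) by (rule sum.swap_restrict)
  also have "\<dots> = (\<Sum>j\<in>J. real (card V) * p j ^ Suc M)"
  proof (rule sum.cong[OF refl])
    fix j assume j: "j \<in> J"
    have "{v. v \<in> V \<and> v \<notin> U j} = V - U j" by auto
    moreover have "card (V - U j) = card V - card (U j)"
      using Suc.prems(2)[OF j] assms(1) by (meson card_Diff_subset finite_subset)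
    moreover have "card (U j) \<le> card V" using Suc.prems(2)[OF j] assms(1) by (simp add: card_mono)
    ultimately show "(\<Sum>v | v \<in> V \<and> v \<notin> U j. p j ^ M) = real (card V) * p j ^ Suc M"
      using n by (simp add: p_def of_nat_diff field_simps)
  qed
  also have "\<dots> = real (card V) * (\<Sum>j\<in>J. p j ^ Suc M)" by (simp add: sum_distrib_left)
  also have "\<dots> < (\<Sum>v\<in>V. 1)" using Suc.prems(3) n by (simp add: p_def)
  finally obtain v where v: "v \<in> V" "(\<Sum>j | j \<in> J \<and> v \<notin> U j. p j ^ M) < 1"
    by (meson not_le sum_mono)
  have "\<exists>C\<subseteq>V. card C \<le> M \<and> (\<forall>j\<in>{j \<in> J. v \<notin> U j}. C \<inter> U j \<noteq> {})"
    by (rule Suc.IH) (use Suc.prems v in \<open>auto simp: p_def\<close>)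
  then obtain C where C: "C \<subseteq> V" "card C \<le> M" "\<forall>j\<in>{j \<in> J. v \<notin> U j}. C \<inter> U j \<noteq> {}" by blast
  have "card (insert v C) \<le> Suc M"
    using C(2) card_insert_le_m1[of "Suc M" C v] by simp
  then show ?case using C v by (intro exI[of _ "insert v C"]) auto
qed

lemma sum_power_card_Pow:
  fixes b :: real
  assumes "finite V"
  shows "(\<Sum>S\<in>Pow V. b ^ card S) = (1 + b) ^ card V"
  using assms
proof (induction V rule: finite_induct)
  case (insert v V)
  have "(\<Sum>S\<in>insert v ` Pow V. b ^ card S) = (\<Sum>S\<in>Pow V. b * b ^ card S)"
  proof (subst sum.reindex)
    show "inj_on (insert v) (Pow V)" using insert.hyps by (auto simp: inj_on_def)
    have "b ^ card (insert v S) = b * b ^ card S" if "S \<subseteq> V" for S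
      using that insert.hyps finite_subset[of S V] by (subst card_insert_disjoint) auto
    then show "sum ((\<lambda>S. b ^ card S) \<circ> insert v) (Pow V) = (\<Sum>S\<in>Pow V. b * b ^ card S)"
      by (intro sum.cong) auto
  qed
  then have "(\<Sum>S\<in>Pow (insert v V). b ^ card S) = (\<Sum>S\<in>Pow V. b ^ card S) + b * (\<Sum>S\<in>Pow V. b ^ card S)"
    using insert.hyps
    by (simp add: Pow_insert sum_distrib_left, subst sum.union_disjoint) auto
  then show ?case using insert by (simp add: algebra_simps)
qed simp

text \<open>If \<open>S\<close> violates the conclusion, \<open>C\<close> misses
  \<open>R S - Z\<close> for the small set \<open>Z = C \<inter> R S\<close>. So it suffices to hit
  \<open>R S - Z\<close> for all pairs with \<open>card Z \<le> card S\<close>; each of these sets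
  has at least \<open>(K - 1) * card S\<close> elements.\<close>

lemma expanding_sets_hit_often:
  fixes R :: "'a set \<Rightarrow> 'a set" and K :: real
  assumes "finite V" "V \<noteq> {}" "\<And>S. S \<subseteq> V \<Longrightarrow> R S \<subseteq> V" "K \<ge> 1"
    and small: "real (card V) * exp (- ((K - 1) * real M / (2 * real (card V)))) \<le> 1 / 4"
  shows "\<exists>C\<subseteq>V. card C \<le> M \<and> (\<forall>S\<subseteq>V. K * real (card S) \<le> real (card (R S)) \<longrightarrow> card S \<le> card (C \<inter> R S))"
proof -
  define n where "n = card V"
  \<comment> \<open>A pair \<open>(S, Z)\<close> is missed with probability at most
    \<open>b ^ (2 * card S)\<close>. Weakening this to \<open>b ^ card S * b ^ card Z\<close> makes
    the sum over all pairs factor.\<close>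
  define b where "b = exp (- ((K - 1) * real M / (2 * real n)))"
  define J where "J = {(S, Z). S \<subseteq> V \<and> S \<noteq> {} \<and> Z \<subseteq> V \<and> card Z \<le> card S \<and> K * real (card S) \<le> real (card (R S))}"
  have n: "n > 0" using assms(1,2) by (simp add: card_gt_0_iff n_def)
  have b: "0 < b" "b \<le> 1" using assms(4) by (auto simp: b_def)
  have J: "J \<subseteq> (Pow V - {{}}) \<times> Pow V" by (auto simp: J_def)
  then have finJ: "finite J" using assms(1) by (meson finite_Diff finite_Pow_iff finite_SigmaI finite_subset)
  have le: "(1 - real (card (R S - Z)) / real n) ^ M \<le> b ^ card S * b ^ card Z" if "(S, Z) \<in> J" for S Z
  proof -
    have SZ: "S \<subseteq> V" "Z \<subseteq> V" "card Z \<le> card S" "K * real (card S) \<le> real (card (R S))"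
      using that by (auto simp: J_def)
    have fin: "finite Z" "finite (R S)" using SZ assms(1,3) by (meson finite_subset)+
    have "real (card (R S)) \<le> real (card (R S - Z)) + real (card Z)"
      using diff_card_le_card_Diff[OF fin(1), of "R S"] by linarith
    then have "(K - 1) * real (card S) \<le> real (card (R S - Z))"
      using SZ by (simp add: algebra_simps)
    then have "1 - real (card (R S - Z)) / real n \<le> 1 + (- ((K - 1) * real (card S) / real n))"
      using n by (simp add: divide_right_mono)
    also have "\<dots> \<le> exp (- ((K - 1) * real (card S) / real n))" by (rule exp_ge_add_one_self)
    finally have 1: "1 - real (card (R S - Z)) / real n \<le> exp (- ((K - 1) * real (card S) / real n))" .
    have "card (R S - Z) \<le> n" unfolding n_def using assms(1,3) SZ by (intro card_mono) auto
    then have "0 \<le> 1 - real (card (R S - Z)) / real n" using n by simp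
    then have "(1 - real (card (R S - Z)) / real n) ^ M \<le> exp (- ((K - 1) * real (card S) / real n)) ^ M"
      using 1 by (rule power_mono[rotated])
    also have "\<dots> = b ^ card S * b ^ card S"
      unfolding b_def using n
      by (simp add: exp_of_nat_mult[symmetric] exp_add[symmetric] field_simps)
    also have "\<dots> \<le> b ^ card S * b ^ card Z"
      using b SZ by (intro mult_left_mono power_decreasing) auto
    finally show ?thesis .
  qed
  have "(\<Sum>j\<in>J. (1 - real (card (case j of (S, Z) \<Rightarrow> R S - Z)) / real n) ^ M)
      \<le> (\<Sum>j\<in>J. case j of (S, Z) \<Rightarrow> b ^ card S * b ^ card Z)"
    by (intro sum_mono) (use le in auto)
  also have "\<dots> \<le> (\<Sum>j\<in>(Pow V - {{}}) \<times> Pow V. case j of (S, Z) \<Rightarrow> b ^ card S * b ^ card Z)"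
    using J assms(1) b by (intro sum_mono2) auto
  also have "\<dots> = (\<Sum>S\<in>Pow V - {{}}. b ^ card S) * (\<Sum>Z\<in>Pow V. b ^ card Z)"
    by (simp add: sum.cartesian_product[symmetric] sum_product)
  also have "\<dots> = ((1 + b) ^ n - 1) * (1 + b) ^ n"
    using assms(1) by (simp add: sum_diff1 sum_power_card_Pow n_def)
  \<comment> \<open>The assumption \<open>small\<close> says \<open>n * b \<le> 1 / 4\<close>,
    whence \<open>(1 + b) ^ n \<le> 21 / 16\<close>, and
    \<open>5 / 16 * 21 / 16 < 1\<close>.\<close>
  also have "\<dots> < 1"
  proof -
    have "(1 + b) ^ n \<le> exp b ^ n" using b by (intro power_mono exp_ge_add_one_self) auto
    also have "\<dots> = exp (real n * b)" by (simp add: exp_of_nat_mult)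
    also have "\<dots> \<le> exp (1 / 4)" using small by (simp add: b_def n_def)
    also have "\<dots> \<le> 1 + 1 / 4 + (1 / 4)\<^sup>2" by (rule exp_bound) auto
    finally have *: "(1 + b) ^ n \<le> 21 / 16" by (simp add: power2_eq_square)
    have "1 \<le> (1 + b) ^ n" using b by simp
    then have "((1 + b) ^ n - 1) * (1 + b) ^ n \<le> (21 / 16 - 1) * (21 / 16)"
      using * by (intro mult_mono) auto
    then show ?thesis by simp
  qed
  finally have sum: "(\<Sum>j\<in>J. (1 - real (card (case j of (S, Z) \<Rightarrow> R S - Z)) / real (card V)) ^ M) < 1"
    unfolding n_def .
  have sub: "(case j of (S, Z) \<Rightarrow> R S - Z) \<subseteq> V" if "j \<in> J" for j
  proof -
    obtain S Z where j: "j = (S, Z)" by (cases j)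
    then have "R S \<subseteq> V" using that assms(3)[of S] by (simp add: J_def)
    then show ?thesis using j by auto
  qed
  have "\<exists>C\<subseteq>V. card C \<le> M \<and> (\<forall>j\<in>J. C \<inter> (case j of (S, Z) \<Rightarrow> R S - Z) \<noteq> {})"
    using hitting_set[OF assms(1,2) finJ sub sum] .
  then obtain C where C: "C \<subseteq> V" "card C \<le> M"
    and "\<forall>j\<in>J. C \<inter> (case j of (S, Z) \<Rightarrow> R S - Z) \<noteq> {}" by blast
  then have hit: "C \<inter> (R S - Z) \<noteq> {}" if "(S, Z) \<in> J" for S Z
    using that by (metis (no_types, lifting) case_prod_conv)
  have "card S \<le> card (C \<inter> R S)" if S: "S \<subseteq> V" "K * real (card S) \<le> real (card (R S))" for S
  proof (rule ccontr)
    assume "\<not> card S \<le> card (C \<inter> R S)"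
    then have "(S, C \<inter> R S) \<in> J" using S C(1) by (cases "S = {}") (auto simp: J_def)
    from hit[OF this] show False by blast
  qed
  then show ?thesis using C by blast
qed

section \<open>Enforcing properties of the robber's play\<close>

text \<open>The cops either capture the robber or force his entire play to satisfy \<open>P\<close>.
  Such partial successes add up, one group of cops for each, until the conjunction is
  contradictory.\<close>

definition enforces :: "'a pair_pre_digraph \<Rightarrow> nat \<Rightarrow> ((nat \<Rightarrow> 'a) \<Rightarrow> bool) \<Rightarrow> bool" where
  "enforces G k P \<longleftrightarrow>
     (\<exists>s. cop_strategy G k s \<and>
        (\<forall>r. robber_play G r \<longrightarrow> P r \<or> (\<exists>m. \<exists>i<k. s (map r [0..<Suc m]) i = r m)))"

lemma cops_win_if_enforces_False: "enforces G k (\<lambda>_. False) \<Longrightarrow> cops_win G k"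
  by (simp add: enforces_def cops_win_def)

lemma enforces_weaken:
  "enforces G k P \<Longrightarrow> (\<And>r. robber_play G r \<Longrightarrow> P r \<Longrightarrow> Q r) \<Longrightarrow> enforces G k Q"
  unfolding enforces_def by blast

lemma enforces_conj:
  assumes "enforces G k P" "enforces G l Q"
  shows "enforces G (k + l) (\<lambda>r. P r \<and> Q r)"
proof -
  obtain s where s: "cop_strategy G k s"
    "\<And>r. robber_play G r \<Longrightarrow> P r \<or> (\<exists>m. \<exists>i<k. s (map r [0..<Suc m]) i = r m)"
    using assms(1) by (auto simp: enforces_def)
  obtain s' where s': "cop_strategy G l s'"
    "\<And>r. robber_play G r \<Longrightarrow> Q r \<or> (\<exists>m. \<exists>i<l. s' (map r [0..<Suc m]) i = r m)"
    using assms(2) by (auto simp: enforces_def)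
  define s'' where "s'' h i = (if i < k then s h i else s' h (i - k))" for h i
  have "cop_strategy G (k + l) s''"
    using s(1) s'(1) unfolding cop_strategy_def s''_def by (simp del: upt_Suc)
  moreover have "(P r \<and> Q r) \<or> (\<exists>m. \<exists>i<k+l. s'' (map r [0..<Suc m]) i = r m)"
    if r: "robber_play G r" for r
  proof -
    have "\<exists>m. \<exists>i<k+l. s'' (map r [0..<Suc m]) i = r m"
      if "i < k" "s (map r [0..<Suc m]) i = r m" for i m
      using that by (intro exI[of _ m] exI[of _ i]) (simp add: s''_def del: upt_Suc)
    moreover have "\<exists>m. \<exists>i<k+l. s'' (map r [0..<Suc m]) i = r m"
      if "i < l" "s' (map r [0..<Suc m]) i = r m" for i m
      using that by (intro exI[of _ m] exI[of _ "k + i"]) (simp add: s''_def del: upt_Suc)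
    ultimately show ?thesis using s(2)[OF r] s'(2)[OF r] by blast
  qed
  ultimately show ?thesis unfolding enforces_def by blast
qed

lemma enforces_True:
  assumes "v \<in> pverts G"
  shows "enforces G k (\<lambda>_. True)"
  unfolding enforces_def cop_strategy_def legal_move_def
  using assms by (intro exI[of _ "\<lambda>_ _. v"]) simp

lemma enforces_mono:
  assumes "enforces G k P" "k \<le> l" "pverts G \<noteq> {}"
  shows "enforces G l P"
proof -
  obtain v where "v \<in> pverts G" using assms(3) by blast
  then have "enforces G (k + (l - k)) (\<lambda>r. P r \<and> True)"
    by (intro enforces_conj assms(1) enforces_True)
  then show ?thesis using assms(2) by simp
qed

text \<open>Cop \<open>i\<close> waits at \<open>c i\<close> until he sees \<open>r \<tau>\<close>,
  walks to a target depending on the play so far, and captures the robber if he then comes within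
  one move.\<close>

lemma enforces_strike:
  assumes c: "\<And>i. i < k \<Longrightarrow> c i \<in> pverts G"
    and x: "\<And>h i. i < k \<Longrightarrow> (legal_move G ^^ t) (c i) (x h i)"
  shows "enforces G k (\<lambda>r. \<forall>i<k. \<not> legal_move G (x (map r [0..<Suc \<tau>]) i) (r (\<tau> + t)))"
proof -
  define walk where "walk h i p \<longleftrightarrow> p 0 = c i \<and> p t = x h i \<and> (\<forall>j<t. legal_move G (p j) (p (Suc j)))" for h i p
  define p where "p h i = (SOME p. walk h i p)" for h i
  have "walk h i (p h i)" if "i < k" for h i
  proof -
    have "\<exists>p. walk h i p" using x[OF that, of h] by (auto simp: walk_def relpowp_fun_conv)
    then show ?thesis unfolding p_def by (rule someI_ex)
  qed
  then have p: "\<And>h i. i < k \<Longrightarrow> p h i 0 = c i" "\<And>h i. i < k \<Longrightarrow> p h i t = x h i"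
    "\<And>h i j. i < k \<Longrightarrow> j < t \<Longrightarrow> legal_move G (p h i j) (p h i (Suc j))"
    unfolding walk_def by blast+
  \<comment> \<open>A history of length \<open>m + 1\<close> ends in \<open>r m\<close>. The
    \<open>t\<close> steps of the walk answer \<open>r \<tau>\<close> up to
    \<open>r (\<tau> + t - 1)\<close>, and the strike answers \<open>r (\<tau> + t)\<close>.\<close>
  define s where "s h i =
     (if length h \<le> \<tau> then c i
      else if length h \<le> \<tau> + t then p (take (Suc \<tau>) h) i (length h - \<tau>)
      else if legal_move G (x (take (Suc \<tau>) h) i) (h ! (\<tau> + t)) then h ! (\<tau> + t)
      else x (take (Suc \<tau>) h) i)" for h i
  have take: "take (Suc \<tau>) (map r [0..<m]) = map r [0..<Suc \<tau>]" if "\<tau> < m" for r :: "nat \<Rightarrow> 'a" and m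
    using that by (simp add: take_map del: upt_Suc)
  have s: "s (map r [0..<m]) i =
     (if m \<le> \<tau> then c i
      else if m \<le> \<tau> + t then p (map r [0..<Suc \<tau>]) i (m - \<tau>)
      else if legal_move G (x (map r [0..<Suc \<tau>]) i) (r (\<tau> + t)) then r (\<tau> + t)
      else x (map r [0..<Suc \<tau>]) i)" for r m i
    unfolding s_def using take[of m r] by (simp del: upt_Suc)
  have "legal_move G (s (map r [0..<m]) i) (s (map r [0..<Suc m]) i)" if i: "i < k" for r m i
  proof -
    have stay: "legal_move G u u" for u by (simp add: legal_move_def)
    consider "Suc m \<le> \<tau>" | "m = \<tau>" "t = 0" | "m = \<tau>" "t > 0" | "\<tau> < m" "m < \<tau> + t"
      | "\<tau> < m" "m = \<tau> + t" | "\<tau> + t < m" by linarith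
    then show ?thesis
    proof cases
      case 1 then show ?thesis by (simp add: s stay del: upt_Suc)
    next
      case 2
      then have "x h i = c i" for h using p(1,2)[OF i, of h] by simp
      then show ?thesis using 2 by (simp add: s stay del: upt_Suc)
    next
      case 3
      then show ?thesis using p(3)[OF i, of 0] p(1)[OF i] by (simp add: s del: upt_Suc)
    next
      case 4
      then show ?thesis using p(3)[OF i, of "m - \<tau>"] by (simp add: s Suc_diff_le del: upt_Suc)
    next
      case 5
      then show ?thesis using p(2)[OF i] by (simp add: s stay del: upt_Suc)
    next
      case 6
      then show ?thesis by (simp add: s stay del: upt_Suc)
    qed
  qed
  then have "cop_strategy G k s" using c unfolding cop_strategy_def by (simp add: s_def del: upt_Suc)
  moreover have "\<exists>m. \<exists>i<k. s (map r [0..<Suc m]) i = r m"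
    if "i < k" "legal_move G (x (map r [0..<Suc \<tau>]) i) (r (\<tau> + t))" for r i
    using that by (intro exI[of _ "\<tau> + t"] exI[of _ i]) (simp add: s del: upt_Suc)
  ultimately show ?thesis unfolding enforces_def by blast
qed

lemma enforces_strike_set:
  fixes G :: "'a pair_pre_digraph"
  assumes "finite C" "C \<subseteq> pverts G"
    and "\<And>h. inj_on (f h) (D h)" "\<And>h y. y \<in> D h \<Longrightarrow> f h y \<in> C \<and> (legal_move G ^^ t) (f h y) (g h y)"
  shows "enforces G (card C) (\<lambda>r. \<forall>y\<in>D (map r [0..<Suc \<tau>]).
    \<not> legal_move G (g (map r [0..<Suc \<tau>]) y) (r (\<tau> + t)))"
proof -
  obtain e where e: "bij_betw e {..<card C} C"
    using ex_bij_betw_nat_finite[OF assms(1)] by (auto simp: atLeast0LessThan)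
  \<comment> \<open>Cops are named by their starting vertices; \<open>f h y\<close> is sent to
    \<open>g h y\<close>, and a cop without a task stays where he is.\<close>
  define x where "x h i = (if e i \<in> f h ` D h then g h (the_inv_into (D h) (f h) (e i)) else e i)" for h i
  have "(legal_move G ^^ t) u u" for u
    by (induction t) (auto simp: legal_move_def relcompp.simps)
  then have "(legal_move G ^^ t) (e i) (x h i)" if "i < card C" for h i
    using assms(3)[of h] assms(4)[of _ h] by (auto simp: x_def the_inv_into_f_f)
  then have "enforces G (card C) (\<lambda>r. \<forall>i<card C. \<not> legal_move G (x (map r [0..<Suc \<tau>]) i) (r (\<tau> + t)))"
    using e assms(2) by (intro enforces_strike) (use bij_betw_apply in fastforce)+
  then show ?thesis
  proof (rule enforces_weaken)
    fix r :: "nat \<Rightarrow> 'a"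
    let ?h = "map r [0..<Suc \<tau>]"
    assume *: "\<forall>i<card C. \<not> legal_move G (x ?h i) (r (\<tau> + t))"
    show "\<forall>y\<in>D ?h. \<not> legal_move G (g ?h y) (r (\<tau> + t))"
    proof
      fix y assume y: "y \<in> D ?h"
      then have "f ?h y \<in> C" using assms(4) by blast
      then obtain i where i: "i < card C" "e i = f ?h y"
        using e unfolding bij_betw_def by (metis imageE lessThan_iff)
      then have "x ?h i = g ?h y"
        unfolding x_def using y assms(3)[of ?h] by (simp add: the_inv_into_f_f del: upt_Suc)
      then show "\<not> legal_move G (g ?h y) (r (\<tau> + t))" using * i by metis
    qed
  qed
qed

section \<open>Neighbourhoods\<close>

text \<open>The ball \<open>B(S, t)\<close>: staying is a legal move, so \<open>t\<close> moves
  cover all distances up to \<open>t\<close>.\<close>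

definition nbhd :: "'a pair_pre_digraph \<Rightarrow> nat \<Rightarrow> 'a set \<Rightarrow> 'a set" where
  "nbhd G t S = {v. \<exists>u\<in>S. (legal_move G ^^ t) u v}"

lemma legal_move_refl [simp]: "legal_move G u u"
  by (simp add: legal_move_def)

lemma legal_moves_mono: "(legal_move G ^^ t) u v \<Longrightarrow> t \<le> t' \<Longrightarrow> (legal_move G ^^ t') u v"
proof (induction t' arbitrary: v)
  case (Suc t')
  show ?case
  proof (cases "t = Suc t'")
    case False
    then have "(legal_move G ^^ t') u v" using Suc by simp
    then show ?thesis by (auto intro: relpowp_Suc_I)
  qed (use Suc in simp)
qed simp

lemma nbhd_Un: "nbhd G t (S \<union> T) = nbhd G t S \<union> nbhd G t T"
  by (auto simp: nbhd_def)

lemma robber_play_legal_moves: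
  "robber_play G r \<Longrightarrow> (legal_move G ^^ j) (r m) (r (m + j))"
  by (induction j) (auto simp: robber_play_def intro: relpowp_Suc_I)

context pair_graph
begin

lemma legal_move_verts: "legal_move G u v \<Longrightarrow> u \<in> pverts G \<Longrightarrow> v \<in> pverts G"
  by (auto simp: legal_move_def dest: in_arcsD2)

lemma legal_moves_verts: "(legal_move G ^^ t) u v \<Longrightarrow> u \<in> pverts G \<Longrightarrow> v \<in> pverts G"
  by (induction t arbitrary: v) (auto intro: legal_move_verts)

lemma legal_move_sym: "legal_move G u v \<Longrightarrow> legal_move G v u"
  using arcs_symmetric by (auto simp: legal_move_def)

lemma legal_moves_sym: "(legal_move G ^^ t) u v \<Longrightarrow> (legal_move G ^^ t) v u"
proof (induction t arbitrary: v)
  case (Suc t)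
  then obtain w where w: "(legal_move G ^^ t) u w" "legal_move G w v" by auto
  then have "(legal_move G ^^ t) w u" using Suc.IH by blast
  then show ?case using legal_move_sym[OF w(2)] by (rule relpowp_Suc_I2[rotated])
qed simp

lemma nbhd_verts: "S \<subseteq> pverts G \<Longrightarrow> nbhd G t S \<subseteq> pverts G"
  unfolding nbhd_def using legal_moves_verts by blast

lemma robber_in_verts: "robber_play G r \<Longrightarrow> r m \<in> pverts G"
  by (induction m) (auto simp: robber_play_def intro: legal_move_verts)

text \<open>As long as some vertex sees more than \<open>q\<close> undominated elements of
  \<open>F\<close>, it joins \<open>D\<close>. Each addition uses up more than \<open>q\<close>
  elements of \<open>F\<close>, which bounds \<open>card D * q\<close>.\<close>

lemma greedy_dominating_set:
  fixes q :: real
  assumes "finite F" "q > 0"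
  shows "\<exists>D\<subseteq>pverts G. real (card D) * q \<le> real (card F) \<and>
    (\<forall>x\<in>pverts G. real (card {w \<in> F. legal_move G x w \<and> (\<forall>y\<in>D. \<not> legal_move G y w)}) \<le> q)"
  using assms(1)
proof (induction "card F" arbitrary: F rule: less_induct)
  case less
  show ?case
  proof (cases "\<exists>x\<in>pverts G. real (card {w \<in> F. legal_move G x w}) > q")
    case False
    then show ?thesis by (intro exI[of _ "{}"]) (auto simp: not_less)
  next
    case True
    then obtain x where x: "x \<in> pverts G" "real (card {w \<in> F. legal_move G x w}) > q" by blast
    define F' where "F' = {w \<in> F. \<not> legal_move G x w}"
    have "F = F' \<union> {w \<in> F. legal_move G x w}" by (auto simp: F'_def)
    then have card: "card F = card F' + card {w \<in> F. legal_move G x w}"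
      using less.prems by (metis (no_types, lifting) F'_def card_Un_disjoint disjoint_iff finite_Un mem_Collect_eq)
    then have "card F' < card F" using x(2) assms(2) by linarith
    then have "\<exists>D\<subseteq>pverts G. real (card D) * q \<le> real (card F') \<and>
      (\<forall>x\<in>pverts G. real (card {w \<in> F'. legal_move G x w \<and> (\<forall>y\<in>D. \<not> legal_move G y w)}) \<le> q)"
      by (rule less.hyps) (use less.prems in \<open>simp add: F'_def\<close>)
    then obtain D where D: "D \<subseteq> pverts G" "real (card D) * q \<le> real (card F')"
      "\<forall>x\<in>pverts G. real (card {w \<in> F'. legal_move G x w \<and> (\<forall>y\<in>D. \<not> legal_move G y w)}) \<le> q" by blast
    have "real (card (insert x D)) * q \<le> (real (card D) + 1) * q"
      using assms(2) card_insert_le_m1[of "Suc (card D)" D x] by (intro mult_right_mono) auto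
    also have "\<dots> \<le> real (card F)" using D(2) card x(2) by (simp add: algebra_simps)
    moreover have "{w \<in> F. legal_move G z w \<and> (\<forall>y\<in>insert x D. \<not> legal_move G y w)}
      = {w \<in> F'. legal_move G z w \<and> (\<forall>y\<in>D. \<not> legal_move G y w)}" for z
      by (auto simp: F'_def)
    ultimately show ?thesis using D x(1) by (intro exI[of _ "insert x D"]) auto
  qed
qed

end

section \<open>Teams of cops\<close>

text \<open>The assumption \<open>teams\<close> provides one team for each radius \<open>t\<close>
  and hides the random choice; everything in the locale is deterministic.\<close>

locale cop_teams = pair_graph G for G :: "'a pair_pre_digraph" +
  fixes M :: nat and K :: real
  assumes verts_nonempty: "pverts G \<noteq> {}" and K_pos: "K > 0"
    and teams: "\<exists>C\<subseteq>pverts G. card C \<le> M \<and>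
      (\<forall>S\<subseteq>pverts G. K * real (card S) \<le> real (card (nbhd G t S)) \<longrightarrow> card S \<le> card (C \<inter> nbhd G t S))"
begin

lemma finite_verts_subset: "S \<subseteq> pverts G \<Longrightarrow> finite S"
  using pair_finite_verts by (rule finite_subset[rotated])

text \<open>Take \<open>T\<close> maximal among the subsets of \<open>D\<close> that do not expand
  by more than \<open>K\<close>. Balls are subadditive, so by maximality every
  \<open>Y \<subseteq> D - T\<close> expands by at least \<open>K\<close>, and Hall's condition
  holds on \<open>D - T\<close>.\<close>

lemma team_matching:
  assumes C: "C \<subseteq> pverts G"
    "\<And>S. S \<subseteq> pverts G \<Longrightarrow> K * real (card S) \<le> real (card (nbhd G t S)) \<Longrightarrow> card S \<le> card (C \<inter> nbhd G t S)"
    and D: "D \<subseteq> pverts G"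
  shows "\<exists>T f. T \<subseteq> D \<and> real (card (nbhd G t T)) \<le> K * real (card T) \<and> inj_on f (D - T) \<and>
    (\<forall>y\<in>D - T. f y \<in> C \<and> (legal_move G ^^ t) (f y) y)"
proof -
  define \<T> where "\<T> = {T. T \<subseteq> D \<and> real (card (nbhd G t T)) \<le> K * real (card T)}"
  have "finite \<T>" using finite_verts_subset[OF D] by (auto simp: \<T>_def)
  moreover have "{} \<in> \<T>" by (auto simp: \<T>_def nbhd_def)
  ultimately obtain T where T: "T \<in> \<T>" "\<And>T'. T' \<in> \<T> \<Longrightarrow> T \<subseteq> T' \<Longrightarrow> T = T'"
    using finite_has_maximal2[of \<T> "{}"] by blast
  have TD: "T \<subseteq> D" and Tle: "real (card (nbhd G t T)) \<le> K * real (card T)"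
    using T(1) by (auto simp: \<T>_def)
  have expand: "card Y \<le> card (C \<inter> nbhd G t Y)" if Y: "Y \<subseteq> D - T" for Y
  proof (cases "Y = {}")
    case False
    have fin: "finite T" "finite Y" using TD Y D finite_verts_subset by blast+
    have "T \<union> Y \<notin> \<T>" using T(2)[of "T \<union> Y"] Y False by blast
    then have "K * real (card (T \<union> Y)) < real (card (nbhd G t (T \<union> Y)))"
      using TD Y by (auto simp: \<T>_def)
    also have "\<dots> \<le> real (card (nbhd G t T)) + real (card (nbhd G t Y))"
      unfolding nbhd_Un by (metis card_Un_le of_nat_add of_nat_le_iff)
    also have "card (T \<union> Y) = card T + card Y" using fin Y by (intro card_Un_disjoint) auto
    finally have "K * real (card Y) \<le> real (card (nbhd G t Y))"
      using Tle by (simp add: algebra_simps)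
    then show ?thesis using C(2) Y D by blast
  qed simp
  have "\<exists>f. inj_on f (D - T) \<and> (\<forall>y\<in>D - T. f y \<in> C \<inter> nbhd G t {y})"
  proof (rule marriage)
    show "card Y \<le> card (\<Union>y\<in>Y. C \<inter> nbhd G t {y})" if "Y \<subseteq> D - T" for Y
    proof -
      have "(\<Union>y\<in>Y. C \<inter> nbhd G t {y}) = C \<inter> nbhd G t Y" by (auto simp: nbhd_def)
      then show ?thesis using expand[OF that] by simp
    qed
  qed (use finite_verts_subset C(1) D in auto)
  then obtain f where "inj_on f (D - T)" "\<forall>y\<in>D - T. f y \<in> C \<inter> nbhd G t {y}" by blast
  then show ?thesis using TD Tle
    by (intro exI[of _ T] exI[of _ f]) (auto simp: nbhd_def intro: legal_moves_sym)
qed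

text \<open>The order of choices matters: \<open>C\<close> is placed before the history
  \<open>h\<close> is known, while \<open>T h\<close> and \<open>f h\<close> react to it.\<close>

lemma team_matching_family:
  assumes D: "\<And>h :: 'h. D h \<subseteq> pverts G"
  obtains C T f where "C \<subseteq> pverts G" "card C \<le> M" "\<And>h. T h \<subseteq> D h"
    "\<And>h. real (card (nbhd G t (T h))) \<le> K * real (card (T h))" "\<And>h. inj_on (f h) (D h - T h)"
    "\<And>h y. y \<in> D h - T h \<Longrightarrow> f h y \<in> C \<and> (legal_move G ^^ t) (f h y) y"
proof -
  obtain C where C: "C \<subseteq> pverts G" "card C \<le> M"
    "\<And>S. S \<subseteq> pverts G \<Longrightarrow> K * real (card S) \<le> real (card (nbhd G t S)) \<Longrightarrow> card S \<le> card (C \<inter> nbhd G t S)"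
    using teams[of t] by blast
  have "\<forall>h. \<exists>T f. T \<subseteq> D h \<and> real (card (nbhd G t T)) \<le> K * real (card T) \<and> inj_on f (D h - T) \<and>
    (\<forall>y\<in>D h - T. f y \<in> C \<and> (legal_move G ^^ t) (f y) y)"
    using team_matching[OF C(1,3) D] by blast
  from choice[OF this] obtain T where "\<forall>h. \<exists>f. T h \<subseteq> D h \<and> real (card (nbhd G t (T h))) \<le> K * real (card (T h)) \<and>
    inj_on f (D h - T h) \<and> (\<forall>y\<in>D h - T h. f y \<in> C \<and> (legal_move G ^^ t) (f y) y)" ..
  from choice[OF this] obtain f where f: "\<forall>h. T h \<subseteq> D h \<and> real (card (nbhd G t (T h))) \<le> K * real (card (T h)) \<and>
    inj_on (f h) (D h - T h) \<and> (\<forall>y\<in>D h - T h. f h y \<in> C \<and> (legal_move G ^^ t) (f h y) y)" ..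
  show ?thesis by (rule that[OF C(1,2), of T f]) (use f in blast)+
qed

text \<open>All \<open>t\<close> moves are spent on reaching \<open>y\<close>; the strike then
  threatens the closed neighbourhood of \<open>y\<close>.\<close>

lemma enforces_team_guard:
  assumes D: "\<And>h. D h \<subseteq> pverts G"
  obtains T where "\<And>h. T h \<subseteq> D h" "\<And>h. real (card (nbhd G t (T h))) \<le> K * real (card (T h))"
    "enforces G M (\<lambda>r. \<forall>y\<in>D (map r [0..<Suc \<tau>]) - T (map r [0..<Suc \<tau>]). \<not> legal_move G y (r (\<tau> + t)))"
proof -
  obtain C T f where C: "C \<subseteq> pverts G" "card C \<le> M"
    and T: "\<And>h. T h \<subseteq> D h" "\<And>h. real (card (nbhd G t (T h))) \<le> K * real (card (T h))"
    and f: "\<And>h. inj_on (f h) (D h - T h)"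
      "\<And>h y. y \<in> D h - T h \<Longrightarrow> f h y \<in> C \<and> (legal_move G ^^ t) (f h y) y"
    using team_matching_family[of D t, OF D] by blast
  have "enforces G (card C) (\<lambda>r. \<forall>y\<in>D (map r [0..<Suc \<tau>]) - T (map r [0..<Suc \<tau>]).
      \<not> legal_move G y (r (\<tau> + t)))"
    by (rule enforces_strike_set[where f = f and g = "\<lambda>_ y. y" and D = "\<lambda>h. D h - T h"])
      (use finite_verts_subset C(1) f in auto)
  then show ?thesis using that[OF T] enforces_mono C(2) verts_nonempty by blast
qed

text \<open>Here the strike is itself the last step towards \<open>y\<close>, so the walk may have
  \<open>t + 1\<close> steps, which explains the radius \<open>Suc t\<close>.\<close>

lemma enforces_team_capture:
  assumes F: "\<And>h. F h \<subseteq> pverts G"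
  obtains S where "\<And>h. S h \<subseteq> F h" "\<And>h. real (card (nbhd G (Suc t) (S h))) \<le> K * real (card (S h))"
    "enforces G M (\<lambda>r. r (\<tau> + t) \<notin> F (map r [0..<Suc \<tau>]) - S (map r [0..<Suc \<tau>]))"
proof -
  obtain C S f where C: "C \<subseteq> pverts G" "card C \<le> M"
    and S: "\<And>h. S h \<subseteq> F h" "\<And>h. real (card (nbhd G (Suc t) (S h))) \<le> K * real (card (S h))"
    and f: "\<And>h. inj_on (f h) (F h - S h)"
      "\<And>h y. y \<in> F h - S h \<Longrightarrow> f h y \<in> C \<and> (legal_move G ^^ Suc t) (f h y) y"
    using team_matching_family[of F "Suc t", OF F] by blast
  \<comment> \<open>The penultimate vertex of the walk, where the cop waits.\<close>
  define g where "g h y = (SOME x. (legal_move G ^^ t) (f h y) x \<and> legal_move G x y)" for h y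
  have "(legal_move G ^^ t) (f h y) (g h y) \<and> legal_move G (g h y) y" if "y \<in> F h - S h" for h y
  proof -
    have "\<exists>x. (legal_move G ^^ t) (f h y) x \<and> legal_move G x y" using f(2)[OF that] by auto
    then show ?thesis unfolding g_def by (rule someI_ex)
  qed
  note g = this
  have "enforces G (card C) (\<lambda>r. \<forall>y\<in>F (map r [0..<Suc \<tau>]) - S (map r [0..<Suc \<tau>]).
      \<not> legal_move G (g (map r [0..<Suc \<tau>]) y) (r (\<tau> + t)))"
    by (rule enforces_strike_set[where f = f and g = g and D = "\<lambda>h. F h - S h"])
      (use finite_verts_subset C(1) f g in auto)
  then have "enforces G (card C) (\<lambda>r. r (\<tau> + t) \<notin> F (map r [0..<Suc \<tau>]) - S (map r [0..<Suc \<tau>]))"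
    by (rule enforces_weaken) (use g in blast)
  then show ?thesis using that[OF S] enforces_mono C(2) verts_nonempty by blast
qed

text \<open>The set \<open>F h\<close> to be avoided at time \<open>\<tau> + t\<close> may depend on the history \<open>h\<close> up to time \<open>\<tau>\<close> only, which
  gives the cops \<open>t + 1\<close> moves to prepare.\<close>
definition excludes :: "nat \<Rightarrow> real \<Rightarrow> nat \<Rightarrow> bool" where
  "excludes t N k \<longleftrightarrow> (\<forall>\<tau> F. (\<forall>h. F h \<subseteq> pverts G \<and> real (card (F h)) \<le> N) \<longrightarrow>
     enforces G k (\<lambda>r. r (\<tau> + t) \<notin> F (map r [0..<Suc \<tau>])))"

lemma excludesD:
  "excludes t N k \<Longrightarrow> (\<And>h. F h \<subseteq> pverts G) \<Longrightarrow> (\<And>h. real (card (F h)) \<le> N) \<Longrightarrow>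
    enforces G k (\<lambda>r. r (\<tau> + t) \<notin> F (map r [0..<Suc \<tau>]))"
  by (simp add: excludes_def)

lemma excludes_antimono: "excludes t N k \<Longrightarrow> N' \<le> N \<Longrightarrow> excludes t N' k"
  unfolding excludes_def by (meson order_trans)

text \<open>A robber who escapes the team is in \<open>S h\<close> at time
  \<open>\<tau> + t\<close>. As \<open>t' - t \<le> t + 1\<close>, he is in
  \<open>nbhd G (Suc t) (S h)\<close> at time \<open>\<tau> + t'\<close>, a set of size at most
  \<open>K * N\<close> that is already known at time \<open>\<tau>\<close>.\<close>

lemma excludes_expand:
  assumes "excludes t' (K * N) k" "t \<le> t'" "t' \<le> 2 * t + 1"
  shows "excludes t N (k + M)"
  unfolding excludes_def
proof (intro allI impI)
  fix \<tau> and F :: "'a list \<Rightarrow> 'a set"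
  assume F: "\<forall>h. F h \<subseteq> pverts G \<and> real (card (F h)) \<le> N"
  then have FV: "F h \<subseteq> pverts G" for h by blast
  obtain S where S: "\<And>h. S h \<subseteq> F h" "\<And>h. real (card (nbhd G (Suc t) (S h))) \<le> K * real (card (S h))"
    "enforces G M (\<lambda>r. r (\<tau> + t) \<notin> F (map r [0..<Suc \<tau>]) - S (map r [0..<Suc \<tau>]))"
    using enforces_team_capture[of F t \<tau>, OF FV] by blast
  have "real (card (nbhd G (Suc t) (S h))) \<le> K * N" for h
  proof -
    have "real (card (S h)) \<le> N"
      using card_mono[OF finite_verts_subset[OF FV] S(1), of h] F by (meson of_nat_mono order_trans)
    then show ?thesis using S(2)[of h] K_pos by (smt (verit) mult_left_mono)
  qed
  moreover have "nbhd G (Suc t) (S h) \<subseteq> pverts G" for h using S(1) FV nbhd_verts by (meson order_trans)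
  ultimately have "enforces G k (\<lambda>r. r (\<tau> + t') \<notin> nbhd G (Suc t) (S (map r [0..<Suc \<tau>])))"
    using excludesD[OF assms(1), of "\<lambda>h. nbhd G (Suc t) (S h)"] by blast
  from enforces_conj[OF this S(3)]
  show "enforces G (k + M) (\<lambda>r. r (\<tau> + t) \<notin> F (map r [0..<Suc \<tau>]))"
  proof (rule enforces_weaken)
    fix r :: "nat \<Rightarrow> 'a"
    let ?h = "map r [0..<Suc \<tau>]"
    assume r: "robber_play G r"
      and *: "r (\<tau> + t') \<notin> nbhd G (Suc t) (S ?h) \<and> r (\<tau> + t) \<notin> F ?h - S ?h"
    have "(legal_move G ^^ (t' - t)) (r (\<tau> + t)) (r (\<tau> + t'))"
      using robber_play_legal_moves[OF r, of "t' - t" "\<tau> + t"] assms(2) by simp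
    then have "(legal_move G ^^ Suc t) (r (\<tau> + t)) (r (\<tau> + t'))"
      by (rule legal_moves_mono) (use assms(3) in linarith)
    then have "r (\<tau> + t) \<notin> S ?h" using * unfolding nbhd_def by blast
    then show "r (\<tau> + t) \<notin> F ?h" using * by blast
  qed
qed

text \<open>The ball around a nonempty \<open>S h\<close> is the whole graph, too large for a set
  expanding by at most \<open>K\<close>. So \<open>S h\<close> is empty and the team alone
  suffices.\<close>

lemma excludes_cover:
  assumes "K * N < real (card (pverts G))"
    and diam: "\<And>u v. u \<in> pverts G \<Longrightarrow> v \<in> pverts G \<Longrightarrow> (legal_move G ^^ Suc t) u v"
  shows "excludes t N M"
  unfolding excludes_def
proof (intro allI impI)
  fix \<tau> and F :: "'a list \<Rightarrow> 'a set"
  assume F: "\<forall>h. F h \<subseteq> pverts G \<and> real (card (F h)) \<le> N"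
  then have FV: "F h \<subseteq> pverts G" for h by blast
  obtain S where S: "\<And>h. S h \<subseteq> F h" "\<And>h. real (card (nbhd G (Suc t) (S h))) \<le> K * real (card (S h))"
    "enforces G M (\<lambda>r. r (\<tau> + t) \<notin> F (map r [0..<Suc \<tau>]) - S (map r [0..<Suc \<tau>]))"
    using enforces_team_capture[of F t \<tau>, OF FV] by blast
  have "S h = {}" for h
  proof (rule ccontr)
    assume "S h \<noteq> {}"
    then have "pverts G \<subseteq> nbhd G (Suc t) (S h)"
      using diam S(1) FV unfolding nbhd_def by blast
    then have "nbhd G (Suc t) (S h) = pverts G"
      using nbhd_verts[of "S h" "Suc t"] S(1) FV by (meson order_trans subset_antisym)
    then have "real (card (pverts G)) \<le> K * real (card (S h))" using S(2)[of h] by simp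
    also have "\<dots> \<le> K * N"
      using card_mono[OF finite_verts_subset[OF FV] S(1), of h] F K_pos
      by (intro mult_left_mono) (meson of_nat_mono order_trans, simp)
    finally show False using assms(1) by simp
  qed
  then show "enforces G M (\<lambda>r. r (\<tau> + t) \<notin> F (map r [0..<Suc \<tau>]))" using S(3) by simp
qed

lemma greedy_dominating_sets:
  fixes q :: real
  assumes "\<And>h :: 'h. F h \<subseteq> pverts G" "q > 0"
  obtains D where "\<And>h. D h \<subseteq> pverts G" "\<And>h. real (card (D h)) * q \<le> real (card (F h))"
    "\<And>h x. x \<in> pverts G \<Longrightarrow>
      real (card {w \<in> F h. legal_move G x w \<and> (\<forall>y\<in>D h. \<not> legal_move G y w)}) \<le> q"
proof -
  have "\<forall>h. \<exists>D\<subseteq>pverts G. real (card D) * q \<le> real (card (F h)) \<and>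
    (\<forall>x\<in>pverts G. real (card {w \<in> F h. legal_move G x w \<and> (\<forall>y\<in>D. \<not> legal_move G y w)}) \<le> q)"
    using greedy_dominating_set[OF finite_verts_subset[OF assms(1)] assms(2)] by blast
  from choice[OF this] show ?thesis using that by blast
qed

text \<open>After greedy domination the robber, who still has to make his last move into \<open>F\<close>, has at most
  \<open>q\<close> undominated vertices to choose from.\<close>
lemma enforces_avoid_undominated:
  assumes "excludes 1 q k" "t \<ge> 1" "q > 0" "\<And>h. F h \<subseteq> pverts G"
    and D: "\<And>h x. x \<in> pverts G \<Longrightarrow>
      real (card {w \<in> F h. legal_move G x w \<and> (\<forall>y\<in>D h. \<not> legal_move G y w)}) \<le> q"
  shows "enforces G k (\<lambda>r. r (\<tau> + t) \<in> F (map r [0..<Suc \<tau>]) \<longrightarrow>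
    (\<exists>y\<in>D (map r [0..<Suc \<tau>]). legal_move G y (r (\<tau> + t))))"
proof -
  \<comment> \<open>The last robber move is treated as a game of its own starting at time
    \<open>\<tau> + t - 1\<close>; \<open>take\<close> recovers the history that \<open>F\<close>
    and \<open>D\<close> depend on. The default \<open>{}\<close> keeps \<open>F' h\<close> small
    for lists that are not plays.\<close>
  define F' where "F' h = (if last h \<in> pverts G
    then {w \<in> F (take (Suc \<tau>) h). legal_move G (last h) w \<and>
      (\<forall>y\<in>D (take (Suc \<tau>) h). \<not> legal_move G y w)} else {})" for h
  have "F' h \<subseteq> pverts G" for h using assms(4) by (auto simp: F'_def)
  moreover have "real (card (F' h)) \<le> q" for h using D assms(3) by (auto simp: F'_def)
  ultimately have "enforces G k (\<lambda>r. r (\<tau> + (t - 1) + 1) \<notin> F' (map r [0..<Suc (\<tau> + (t - 1))]))"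
    by (rule excludesD[OF assms(1)])
  then show ?thesis
  proof (rule enforces_weaken)
    fix r :: "nat \<Rightarrow> 'a"
    let ?h = "map r [0..<Suc \<tau>]"
    assume r: "robber_play G r"
      and *: "r (\<tau> + (t - 1) + 1) \<notin> F' (map r [0..<Suc (\<tau> + (t - 1))])"
    have t: "\<tau> + (t - 1) + 1 = \<tau> + t" using assms(2) by simp
    have h: "take (Suc \<tau>) (map r [0..<Suc (\<tau> + (t - 1))]) = ?h"
      by (simp add: take_map del: upt_Suc)
    have l: "last (map r [0..<Suc (\<tau> + (t - 1))]) = r (\<tau> + (t - 1))" by simp
    have "legal_move G (r (\<tau> + (t - 1))) (r (\<tau> + t))"
      using r t unfolding robber_play_def by (metis Suc_eq_plus1)
    then show "r (\<tau> + t) \<in> F ?h \<longrightarrow> (\<exists>y\<in>D ?h. legal_move G y (r (\<tau> + t)))"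
      using * robber_in_verts[OF r] unfolding F'_def h l t by auto
  qed
qed

text \<open>By \<open>diam\<close> the \<open>M\<close> cops can reach any targets in time, so they
  occupy all of \<open>D h\<close>, which has at most \<open>N / q \<le> M\<close> elements. The
  other \<open>k\<close> cops handle the undominated vertices.\<close>

lemma excludes_dominate:
  assumes "excludes 1 q k" "t \<ge> 1" "q > 0" "N \<le> q * real M"
    and diam: "\<And>u v. u \<in> pverts G \<Longrightarrow> v \<in> pverts G \<Longrightarrow> (legal_move G ^^ t) u v"
  shows "excludes t N (k + M)"
  unfolding excludes_def
proof (intro allI impI)
  fix \<tau> and F :: "'a list \<Rightarrow> 'a set"
  assume F: "\<forall>h. F h \<subseteq> pverts G \<and> real (card (F h)) \<le> N"
  then have FV: "F h \<subseteq> pverts G" for h by blast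
  obtain D where D: "\<And>h. D h \<subseteq> pverts G" "\<And>h. real (card (D h)) * q \<le> real (card (F h))"
    "\<And>h x. x \<in> pverts G \<Longrightarrow>
      real (card {w \<in> F h. legal_move G x w \<and> (\<forall>y\<in>D h. \<not> legal_move G y w)}) \<le> q"
    using greedy_dominating_sets[of F, OF FV assms(3)] by blast
  obtain v where v: "v \<in> pverts G" using verts_nonempty by blast
  have "\<exists>e. D h = e ` {..<card (D h)}" for h
  proof -
    obtain e where "bij_betw e {0..<card (D h)} (D h)"
      using ex_bij_betw_nat_finite finite_verts_subset[OF D(1)] by blast
    then show ?thesis unfolding bij_betw_def atLeast0LessThan by metis
  qed
  then have "\<forall>h. \<exists>e. D h = e ` {..<card (D h)}" by blast
  from choice[OF this] obtain e where e: "\<forall>h. D h = e h ` {..<card (D h)}" ..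
  have DM: "card (D h) \<le> M" for h
  proof -
    have "real (card (D h)) * q \<le> real M * q"
      using D(2)[of h] F assms(4) by (metis mult.commute order_trans)
    then show ?thesis using assms(3) by simp
  qed
  define x where "x h i = (if i < card (D h) then e h i else v)" for h i
  have "x h i \<in> pverts G" for h i using e D(1) v by (auto simp: x_def)
  then have "enforces G M (\<lambda>r. \<forall>i<M. \<not> legal_move G (x (map r [0..<Suc \<tau>]) i) (r (\<tau> + t)))"
    using diam v by (intro enforces_strike[where c = "\<lambda>_. v"]) auto
  then have "enforces G M (\<lambda>r. \<forall>y\<in>D (map r [0..<Suc \<tau>]). \<not> legal_move G y (r (\<tau> + t)))"
  proof (rule enforces_weaken)
    fix r :: "nat \<Rightarrow> 'a"
    let ?h = "map r [0..<Suc \<tau>]"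
    assume *: "\<forall>i<M. \<not> legal_move G (x ?h i) (r (\<tau> + t))"
    have "\<exists>i<M. y = x ?h i" if "y \<in> D ?h" for y
    proof -
      have "y \<in> e ?h ` {..<card (D ?h)}" using that e by blast
      then show ?thesis using DM[of ?h] unfolding x_def by fastforce
    qed
    then show "\<forall>y\<in>D ?h. \<not> legal_move G y (r (\<tau> + t))" using * by blast
  qed
  from enforces_conj[OF enforces_avoid_undominated[where F = F and D = D and \<tau> = \<tau>, OF assms(1,2,3) FV D(3)] this]
  show "enforces G (k + M) (\<lambda>r. r (\<tau> + t) \<notin> F (map r [0..<Suc \<tau>]))"
  proof (rule enforces_weaken)
    fix r :: "nat \<Rightarrow> 'a"
    let ?h = "map r [0..<Suc \<tau>]"
    assume *: "(r (\<tau> + t) \<in> F ?h \<longrightarrow> (\<exists>y\<in>D ?h. legal_move G y (r (\<tau> + t)))) \<and>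
      (\<forall>y\<in>D ?h. \<not> legal_move G y (r (\<tau> + t)))"
    show "r (\<tau> + t) \<notin> F ?h"
    proof
      assume "r (\<tau> + t) \<in> F ?h"
      then obtain y where "y \<in> D ?h" "legal_move G y (r (\<tau> + t))" using * by blast
      then show False using * by blast
    qed
  qed
qed

text \<open>Three groups: \<open>k\<close> cops against undominated vertices, \<open>M\<close> cops
  on \<open>D h - T h\<close>, and \<open>l\<close> cops against a robber dominated only by
  \<open>T h\<close>. The latter is within one move of \<open>T h\<close> at time
  \<open>\<tau> + t\<close>, hence in \<open>nbhd G t (T h)\<close> after \<open>t - 1\<close>
  further moves.\<close>

lemma excludes_dominate_or_expand:
  assumes "excludes 1 q k" "excludes (2 * t - 1) (K * (N / q)) l" "t \<ge> 1" "q > 0"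
  shows "excludes t N (k + l + M)"
  unfolding excludes_def
proof (intro allI impI)
  fix \<tau> and F :: "'a list \<Rightarrow> 'a set"
  assume F: "\<forall>h. F h \<subseteq> pverts G \<and> real (card (F h)) \<le> N"
  then have FV: "F h \<subseteq> pverts G" for h by blast
  obtain D where D: "\<And>h. D h \<subseteq> pverts G" "\<And>h. real (card (D h)) * q \<le> real (card (F h))"
    "\<And>h x. x \<in> pverts G \<Longrightarrow>
      real (card {w \<in> F h. legal_move G x w \<and> (\<forall>y\<in>D h. \<not> legal_move G y w)}) \<le> q"
    using greedy_dominating_sets[of F, OF FV assms(4)] by blast
  obtain T where T: "\<And>h. T h \<subseteq> D h" "\<And>h. real (card (nbhd G t (T h))) \<le> K * real (card (T h))"
    "enforces G M (\<lambda>r. \<forall>y\<in>D (map r [0..<Suc \<tau>]) - T (map r [0..<Suc \<tau>]). \<not> legal_move G y (r (\<tau> + t)))"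
    using enforces_team_guard[of D t \<tau>, OF D(1)] by blast
  have "real (card (nbhd G t (T h))) \<le> K * (N / q)" for h
  proof -
    have "real (card (T h)) \<le> real (card (D h))"
      using card_mono[OF finite_verts_subset[OF D(1)] T(1)] by simp
    also have "\<dots> \<le> N / q"
      using D(2)[of h] F assms(4) by (simp add: pos_le_divide_eq) (meson order_trans)
    finally show ?thesis using T(2)[of h] K_pos by (smt (verit) mult_left_mono)
  qed
  moreover have "nbhd G t (T h) \<subseteq> pverts G" for h using T(1) D(1) nbhd_verts by (meson order_trans)
  ultimately have "enforces G l (\<lambda>r. r (\<tau> + (2 * t - 1)) \<notin> nbhd G t (T (map r [0..<Suc \<tau>])))"
    using excludesD[OF assms(2), of "\<lambda>h. nbhd G t (T h)"] by blast
  from enforces_conj[OF enforces_conj[OF enforces_avoid_undominated[where F = F and D = D and \<tau> = \<tau>, OF assms(1,3,4) FV D(3)] this] T(3)]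
  show "enforces G (k + l + M) (\<lambda>r. r (\<tau> + t) \<notin> F (map r [0..<Suc \<tau>]))"
  proof (rule enforces_weaken)
    fix r :: "nat \<Rightarrow> 'a"
    let ?h = "map r [0..<Suc \<tau>]"
    assume r: "robber_play G r"
      and *: "((r (\<tau> + t) \<in> F ?h \<longrightarrow> (\<exists>y\<in>D ?h. legal_move G y (r (\<tau> + t)))) \<and>
          r (\<tau> + (2 * t - 1)) \<notin> nbhd G t (T ?h)) \<and>
        (\<forall>y\<in>D ?h - T ?h. \<not> legal_move G y (r (\<tau> + t)))"
    show "r (\<tau> + t) \<notin> F ?h"
    proof
      assume "r (\<tau> + t) \<in> F ?h"
      then obtain y where y: "y \<in> T ?h" "legal_move G y (r (\<tau> + t))" using * by blast
      have "(legal_move G ^^ (t - 1)) (r (\<tau> + t)) (r (\<tau> + (2 * t - 1)))"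
        using robber_play_legal_moves[OF r, of "t - 1" "\<tau> + t"] assms(3)
        by (simp add: mult_2 add.assoc)
      with y(2) have "(legal_move G ^^ Suc (t - 1)) y (r (\<tau> + (2 * t - 1)))"
        by (rule relpowp_Suc_I2)
      then show False using * y(1) assms(3) unfolding nbhd_def by auto
    qed
  qed
qed

end

section \<open>Iterating the reduction of the robber's options\<close>

context cop_teams
begin

text \<open>Repeated \<open>excludes_expand\<close> with \<open>t' = 2 * t + 1\<close>, starting
  from \<open>t = 1\<close>.\<close>

lemma excludes_doubling:
  "excludes (2 ^ Suc j - 1) (K ^ j * N) k \<Longrightarrow> excludes 1 N (k + j * M)"
proof (induction j arbitrary: k)
  case (Suc j)
  have "1 \<le> (2::nat) ^ j" by simp
  then have "excludes (2 ^ Suc j - 1) (K ^ j * N) (k + M)"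
    using Suc.prems by (intro excludes_expand[where t' = "2 ^ Suc (Suc j) - 1"]) (simp_all add: mult.assoc)
  from Suc.IH[OF this] show ?case by (simp add: algebra_simps)
qed simp

lemma excludes_base:
  assumes diam: "\<And>u v. u \<in> pverts G \<Longrightarrow> v \<in> pverts G \<Longrightarrow> (legal_move G ^^ (2 ^ L)) u v"
    and "L \<ge> 1" "K ^ L * \<Delta> < real (card (pverts G))"
  shows "excludes 1 \<Delta> (L * M)"
proof -
  obtain j where j: "L = Suc j" using assms(2) by (cases L) auto
  have "Suc (2 ^ L - 1) = 2 ^ L" by simp
  then have "excludes (2 ^ L - 1) (K ^ j * \<Delta>) M"
    using assms(3) diam j by (intro excludes_cover) (auto simp: mult.assoc)
  then show ?thesis using excludes_doubling[of j \<Delta> M] j by simp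
qed

text \<open>The bound \<open>excludes 1 q k\<close> is used twice: for the step into
  \<open>F\<close>, and at time \<open>2 * t - 1\<close>, when \<open>excludes_dominate\<close>
  applies to a ball of size at most \<open>K ^ L * \<Delta> / q \<le> q * M\<close>.\<close>

lemma excludes_step:
  assumes diam: "\<And>u v. u \<in> pverts G \<Longrightarrow> v \<in> pverts G \<Longrightarrow> (legal_move G ^^ (2 ^ L)) u v"
    and "L \<ge> 2" "excludes 1 q k" "q > 0" "K ^ L * \<Delta> \<le> q\<^sup>2 * real M"
  shows "excludes 1 \<Delta> (2 * k + (L + 1) * M)"
proof -
  obtain j where j: "L = Suc j" using assms(2) by (cases L) auto
  define t :: nat where "t = 2 ^ L - 1"
  \<comment> \<open>Needed for \<open>2 ^ L \<le> 2 * t - 1 = 2 ^ (L + 1) - 3\<close>.\<close>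
  have "(2::nat) ^ 2 \<le> 2 ^ L" using assms(2) by (intro power_increasing) auto
  then have t: "t \<ge> 1" "2 ^ L \<le> 2 * t - 1" by (auto simp: t_def)
  have "excludes (2 * t - 1) (K * (K ^ j * \<Delta> / q)) (k + M)"
  proof (rule excludes_dominate[OF assms(3)])
    show "K * (K ^ j * \<Delta> / q) \<le> q * real M"
      using assms(4,5) j by (simp add: divide_le_eq power2_eq_square algebra_simps)
    show "(legal_move G ^^ (2 * t - 1)) u v" if "u \<in> pverts G" "v \<in> pverts G" for u v
      using diam[OF that] t(2) by (rule legal_moves_mono)
  qed (use t assms(4) in auto)
  then have "excludes t (K ^ j * \<Delta>) (k + (k + M) + M)"
    by (rule excludes_dominate_or_expand[OF assms(3)]) (use t assms(4) in auto)
  then have "excludes 1 \<Delta> (k + (k + M) + M + j * M)"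
    using excludes_doubling[of j] j by (simp add: t_def)
  moreover have "k + (k + M) + M + j * M = 2 * k + (L + 1) * M" using j by (simp add: algebra_simps)
  ultimately show ?thesis by metis
qed

end

text \<open>Depends only on \<open>L\<close> and the number of rounds, so it is a constant as
  \<open>n\<close> grows.\<close>

fun team_count :: "nat \<Rightarrow> nat \<Rightarrow> nat" where
  "team_count L 0 = L"
| "team_count L (Suc j) = 2 * team_count L j + L + 1"

text \<open>With \<open>\<Delta> = n powr x\<close> and \<open>q = n powr y\<close>, the condition of the reduction step is
  \<open>x = 2 * y - a\<close> for \<open>a = L * \<kappa> - \<nu>\<close>, so the distance of the exponent to \<open>a\<close> doubles.\<close>
lemma (in cop_teams) excludes_iterated:
  fixes L :: nat and \<kappa> \<nu> w :: real
  defines "n \<equiv> real (card (pverts G))" and "a \<equiv> real L * \<kappa> - \<nu>"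
  assumes diam: "\<And>u v. u \<in> pverts G \<Longrightarrow> v \<in> pverts G \<Longrightarrow> (legal_move G ^^ (2 ^ L)) u v"
    and L: "L \<ge> 2" and n: "n > 1" and K: "K = n powr \<kappa>" and M: "n powr \<nu> \<le> real M"
    and w: "a + w + real L * \<kappa> < 1"
  shows "excludes 1 (n powr (a + 2 ^ j * w)) (team_count L j * M)"
proof (induction j)
  case 0
  have "K ^ L * n powr (a + w) = n powr (a + w + real L * \<kappa>)"
    using n by (simp add: K powr_add powr_realpow[symmetric] powr_powr mult.commute)
  also have "\<dots> < n powr 1" using n w by (intro powr_less_mono) auto
  finally have "excludes 1 (n powr (a + w)) (L * M)"
    by (intro excludes_base diam) (use n L in \<open>auto simp: n_def\<close>)
  then show ?case by simp
next
  case (Suc j)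
  have "K ^ L * n powr (a + 2 ^ Suc j * w) = n powr (real L * \<kappa> + (a + 2 ^ Suc j * w))"
    using n by (simp add: K powr_add powr_realpow[symmetric] powr_powr mult.commute)
  also have "real L * \<kappa> + (a + 2 ^ Suc j * w) = \<nu> + 2 * (a + 2 ^ j * w)"
    by (simp add: a_def)
  also have "n powr \<dots> = n powr \<nu> * (n powr (a + 2 ^ j * w))\<^sup>2"
    by (simp only: powr_add mult_2 power2_eq_square)
  also have "\<dots> \<le> real M * (n powr (a + 2 ^ j * w))\<^sup>2" using M by (intro mult_right_mono) auto
  finally have "K ^ L * n powr (a + 2 ^ Suc j * w) \<le> (n powr (a + 2 ^ j * w))\<^sup>2 * real M"
    by (simp add: mult.commute)
  then have "excludes 1 (n powr (a + 2 ^ Suc j * w)) (2 * (team_count L j * M) + (L + 1) * M)"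
    using n L Suc.IH by (intro excludes_step diam) auto
  then show ?case by (simp add: algebra_simps)
qed

section \<open>Asymptotics\<close>

lemma cop_number_le: "cops_win G k \<Longrightarrow> cop_number G \<le> k"
  unfolding cop_number_def by (rule Least_le)

lemma (in pair_graph) cop_number_le_card: "cop_number G \<le> card (pverts G)"
proof -
  have "enforces G (card (pverts G)) (\<lambda>r. \<forall>y\<in>pverts G. \<not> legal_move G y (r (0 + 0)))"
    using enforces_strike_set[where C = "pverts G" and f = "\<lambda>_ y. y" and g = "\<lambda>_ y. y"
        and D = "\<lambda>_. pverts G" and t = 0 and G = G and \<tau> = 0] pair_finite_verts by simp
  then have "enforces G (card (pverts G)) (\<lambda>_. False)"
    by (rule enforces_weaken) (auto simp: robber_play_def)
  then show ?thesis by (intro cop_number_le cops_win_if_enforces_False)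
qed

lemma (in pair_graph) legal_moves_diameter:
  assumes "graph_diameter G = ereal (real d)" "u \<in> pverts G" "v \<in> pverts G"
  shows "(legal_move G ^^ d) u v"
proof -
  have "\<mu> (\<lambda>_. 1) u v \<le> graph_diameter G"
    unfolding graph_diameter_def using assms(2,3) by (intro SUP_upper2[of u] SUP_upper) auto
  \<comment> \<open>The slack 1 lets a walk be extracted from the infimum; its length is an integer,
    hence at most \<open>d\<close>.\<close>
  also have "\<dots> < ereal (real d + 1)" using assms(1) by simp
  finally obtain p where p: "awalk u p v" "awalk_cost (\<lambda>_. 1) p < real d + 1"
    unfolding \<mu>_def INF_less_iff by auto
  have "awalk_cost (\<lambda>_. 1) p = real (length p)"
    by (induction p) (auto simp: awalk_cost_def)
  then have "length p \<le> d" using p(2) by simp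
  moreover have "(legal_move G ^^ length p) u v"
    using p(1)
  proof (induction p arbitrary: u)
    case Nil
    then show ?case by (simp add: awalk_Nil_iff)
  next
    case (Cons e p)
    then have e: "e \<in> parcs G" "u = fst e" "awalk (snd e) p v" by (auto simp: awalk_Cons_iff)
    then have "legal_move G u (snd e)" by (simp add: legal_move_def)
    from relpowp_Suc_I2[OF this Cons.IH[OF e(3)]] show ?case by simp
  qed
  ultimately show ?thesis by (rule legal_moves_mono[rotated])
qed

lemma cop_number_le_powr_eventually:
  fixes L :: nat and \<delta> :: real
  defines "\<theta> \<equiv> 2 / (2 * real L + 1)"
  assumes L: "L \<ge> 2" and \<delta>: "\<delta> > 0" "\<delta> \<le> \<theta>"
  shows "\<forall>\<^sub>F n in sequentially. \<forall>G :: 'a pair_pre_digraph. pair_graph G \<longrightarrow> card (pverts G) = n \<longrightarrow>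
    (\<forall>u\<in>pverts G. \<forall>v\<in>pverts G. (legal_move G ^^ (2 ^ L)) u v) \<longrightarrow>
    real (cop_number G) \<le> real n powr (1 - \<theta> + \<delta>)"
proof -
  \<comment> \<open>Since \<open>\<kappa> + \<nu> = 1 + \<delta> / 3\<close>, the product
    \<open>K * M\<close> exceeds \<open>n\<close> by a power of \<open>n\<close>, as the random
    teams require. The remaining \<open>\<delta> / 3\<close> in the final exponent absorbs the
    number of teams.\<close>
  define \<kappa> where "\<kappa> = \<theta> - \<delta> / 3"
  define \<nu> where "\<nu> = 1 - \<theta> + 2 * \<delta> / 3"
  define a where "a = real L * \<kappa> - \<nu>"
  \<comment> \<open>Half of the gap that the base case leaves open.\<close>
  define w where "w = (1 - real L * \<kappa> - a) / 2"
  have "2 * real L + 1 \<noteq> 0" by linarith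
  then have \<theta>: "(2 * real L + 1) * \<theta> = 2"
    unfolding \<theta>_def times_divide_eq_right by (rule nonzero_mult_div_cancel_left)
  have "\<theta> < 1" using L by (simp add: \<theta>_def divide_less_eq)
  have pos: "\<kappa> > 0" "\<nu> > 0" using \<delta> \<open>\<theta> < 1\<close> by (auto simp: \<kappa>_def \<nu>_def)
  \<comment> \<open>For \<open>\<delta> = 0\<close> the value would be
    \<open>2 - (2 * L + 1) * \<theta> = 0\<close>: this is where the exponent
    \<open>\<theta>\<close> comes from.\<close>
  have "2 * w = 1 - 2 * (real L * \<kappa>) + \<nu>" by (simp add: w_def a_def)
  also have "\<dots> = 2 - (2 * real L + 1) * \<theta> + (2 * real L + 2) * \<delta> / 3"
    by (simp add: \<kappa>_def \<nu>_def field_simps)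
  finally have "6 * w = (2 * real L + 2) * \<delta>" using \<theta> by simp
  moreover have "(2 * real L + 2) * \<delta> > 0" using \<delta> by (intro mult_pos_pos) auto
  ultimately have w: "w > 0" by linarith
  then have base: "a + w + real L * \<kappa> < 1" unfolding w_def by (simp add: field_simps)
  \<comment> \<open>Enough rounds for the exponent to reach 1, where the robber's options are
    unrestricted.\<close>
  obtain j where j: "(1 - a) / w < 2 ^ j" using real_arch_pow[of 2 "(1 - a) / w"] by auto
  then have j: "1 \<le> a + 2 ^ j * w" using w by (simp add: divide_less_eq)
  define c where "c = real (team_count L j)"
  have c: "c \<ge> 0" by (simp add: c_def)
  have "\<forall>\<^sub>F n in sequentially. real n powr \<kappa> \<ge> 2" using pos by real_asymp
  moreover have "\<forall>\<^sub>F n in sequentially. real n * exp (- (real n powr (\<delta> / 3) / 4)) \<le> 1 / 4"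
    using \<delta> by real_asymp
  moreover have "\<forall>\<^sub>F n in sequentially. c * (real n powr \<nu> + 1) \<le> real n powr (1 - \<theta> + \<delta>)"
  proof -
    have "\<forall>\<^sub>F n in sequentially. c * (real n powr \<nu> + 1) \<le> real n powr (\<nu> + \<delta> / 3)"
      using \<delta> pos by real_asymp
    then show ?thesis by (simp add: \<nu>_def algebra_simps)
  qed
  moreover have "\<forall>\<^sub>F n in sequentially. n \<ge> (2::nat)" by (rule eventually_ge_at_top)
  ultimately show ?thesis
  proof eventually_elim
    case (elim n)
    show ?case
    proof (intro allI impI)
      fix G :: "'a pair_pre_digraph"
      assume G: "pair_graph G" and card: "card (pverts G) = n"
        and diam: "\<forall>u\<in>pverts G. \<forall>v\<in>pverts G. (legal_move G ^^ (2 ^ L)) u v"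
      interpret pair_graph G by fact
      define K where "K = real n powr \<kappa>"
      define M where "M = nat \<lceil>real n powr \<nu>\<rceil>"
      have M: "real n powr \<nu> \<le> real M" "real M \<le> real n powr \<nu> + 1"
        using powr_ge_zero[of "real n" \<nu>] unfolding M_def by linarith+
      have n: "real n > 1" using elim by simp
      have "real n powr (\<delta> / 3) * real n = K * real n powr \<nu>"
      proof -
        have "\<kappa> + \<nu> = \<delta> / 3 + 1" by (simp add: \<kappa>_def \<nu>_def)
        then have "K * real n powr \<nu> = real n powr (\<delta> / 3 + 1)" by (simp add: K_def flip: powr_add)
        then show ?thesis using n by (simp add: powr_add)
      qed
      also have "\<dots> \<le> (2 * (K - 1)) * real M"
        using M elim(1) by (intro mult_mono) (auto simp: K_def)
      finally have "real n powr (\<delta> / 3) / 4 \<le> (K - 1) * real M / (2 * real n)"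
        using n by (simp add: field_simps)
      then have "real n * exp (- ((K - 1) * real M / (2 * real n)))
          \<le> real n * exp (- (real n powr (\<delta> / 3) / 4))"
        by (intro mult_left_mono) auto
      also have "\<dots> \<le> 1 / 4" by (rule elim)
      finally have small: "real n * exp (- ((K - 1) * real M / (2 * real n))) \<le> 1 / 4" .
      have nonempty: "pverts G \<noteq> {}" using card n by auto
      interpret cop_teams G M K
      proof
        show "\<exists>C\<subseteq>pverts G. card C \<le> M \<and>
            (\<forall>S\<subseteq>pverts G. K * real (card S) \<le> real (card (nbhd G t S)) \<longrightarrow> card S \<le> card (C \<inter> nbhd G t S))" for t
          using small elim(1) card
          by (intro expanding_sets_hit_often nonempty pair_finite_verts nbhd_verts) (auto simp: K_def)
      qed (use nonempty n in \<open>auto simp: K_def\<close>)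
      have "excludes 1 (real n powr (a + 2 ^ j * w)) (team_count L j * M)"
        using excludes_iterated[of L \<kappa> \<nu> w j] diam L n M(1) base
        by (auto simp: card a_def K_def)
      moreover have "real n powr 1 \<le> real n powr (a + 2 ^ j * w)"
        using n j by (intro powr_mono) auto
      ultimately have "excludes 1 (real n) (team_count L j * M)"
        using n by (auto elim: excludes_antimono)
      \<comment> \<open>The excluded set is the whole graph, so the robber can only have been
        captured.\<close>
      then have "enforces G (team_count L j * M) (\<lambda>r. r (0 + 1) \<notin> pverts G)"
        using card by (intro excludesD[where F = "\<lambda>_. pverts G" and \<tau> = 0]) auto
      then have "enforces G (team_count L j * M) (\<lambda>_. False)"
        by (rule enforces_weaken) (use robber_in_verts in blast)
      then have "real (cop_number G) \<le> real (team_count L j * M)"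
        by (intro of_nat_mono cop_number_le cops_win_if_enforces_False)
      also have "\<dots> \<le> c * (real n powr \<nu> + 1)"
        using M(2) c by (auto simp: c_def intro: mult_left_mono)
      also have "\<dots> \<le> real n powr (1 - \<theta> + \<delta>)" by (rule elim)
      finally show "real (cop_number G) \<le> real n powr (1 - \<theta> + \<delta>)" .
    qed
  qed
qed

section \<open>From every fixed error to one vanishing error\<close>

lemma tendsto_zero_diagonal:
  fixes P :: "nat \<Rightarrow> real \<Rightarrow> bool"
  assumes "\<And>n. P n 1" "\<And>\<delta>. \<delta> > 0 \<Longrightarrow> \<forall>\<^sub>F n in sequentially. P n \<delta>"
  shows "\<exists>\<epsilon>. \<epsilon> \<longlonglongrightarrow> 0 \<and> (\<forall>n. P n (\<epsilon> n))"
proof -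
  \<comment> \<open>\<open>P n 1\<close> makes \<open>k = 0\<close> admissible, and each fixed
    \<open>k\<close> is admissible for all large \<open>n\<close>, so the largest admissible
    \<open>k \<le> n\<close> tends to infinity.\<close>
  define m where "m n = Max {k. k \<le> n \<and> P n (1 / real (Suc k))}" for n
  have fin: "finite {k. k \<le> n \<and> P n (1 / real (Suc k))}" for n by simp
  have "0 \<in> {k. k \<le> n \<and> P n (1 / real (Suc k))}" for n using assms(1) by simp
  then have "m n \<in> {k. k \<le> n \<and> P n (1 / real (Suc k))}" for n
    unfolding m_def by (intro Max_in fin) blast
  then have P: "P n (1 / real (Suc (m n)))" for n by blast
  have "filterlim m at_top sequentially"
    unfolding filterlim_at_top
  proof
    fix k
    have "\<forall>\<^sub>F n in sequentially. P n (1 / real (Suc k))" by (rule assms(2)) simp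
    then show "\<forall>\<^sub>F n in sequentially. k \<le> m n"
      using eventually_ge_at_top[of k]
      by eventually_elim (auto simp: m_def intro!: Max_ge)
  qed
  then have "filterlim (\<lambda>n. 1 / real (Suc (m n))) (nhds 0) sequentially"
    using filterlim_compose[OF LIMSEQ_inverse_real_of_nat] by (simp add: inverse_eq_divide)
  then show ?thesis using P by (intro exI[of _ "\<lambda>n. 1 / real (Suc (m n))"]) auto
qed

lemma le_two_power_ceiling_log:
  assumes "d \<ge> 1"
  shows "d \<le> 2 ^ nat \<lceil>log 2 (real d)\<rceil>"
proof -
  have "real d = 2 powr log 2 (real d)" using assms by simp
  also have "\<dots> \<le> 2 powr real (nat \<lceil>log 2 (real d)\<rceil>)"
    using assms by (intro powr_mono) (auto simp: real_nat_ceiling_ge)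
  also have "\<dots> = real (2 ^ nat \<lceil>log 2 (real d)\<rceil>)" by (simp add: powr_realpow)
  finally show ?thesis by (simp only: of_nat_le_iff)
qed

theorem theorem8:
  shows "\<exists>\<epsilon> :: nat \<Rightarrow> real. \<epsilon> \<longlonglongrightarrow> 0 \<and>
    (\<forall>(G :: 'a pair_pre_digraph) (n :: nat) (d :: nat).
       pair_graph G \<longrightarrow> card (pverts G) = n \<longrightarrow> graph_diameter G = ereal (real d) \<longrightarrow> 3 \<le> d \<longrightarrow>
       real (cop_number G) \<le>
         real n powr (1 - 2 / (2 * real_of_int \<lceil>log 2 (real d)\<rceil> + 1) + \<epsilon> n))"
proof -
  define P where "P n \<delta> \<longleftrightarrow> (\<forall>(G :: 'a pair_pre_digraph) (d :: nat).
      pair_graph G \<longrightarrow> card (pverts G) = n \<longrightarrow> graph_diameter G = ereal (real d) \<longrightarrow> 3 \<le> d \<longrightarrow>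
      real (cop_number G) \<le> real n powr (1 - 2 / (2 * real_of_int \<lceil>log 2 (real d)\<rceil> + 1) + \<delta>))"
    for n :: nat and \<delta> :: real
  have trivial: "real (cop_number G) \<le> real n powr x"
    if G: "pair_graph G" "card (pverts G) = n" "graph_diameter G = ereal (real d)" and x: "1 \<le> x"
    for G :: "'a pair_pre_digraph" and n d x
  proof -
    \<comment> \<open>For the empty graph the diameter is an empty supremum,
      \<open>-\<infinity>\<close>.\<close>
    have "pverts G \<noteq> {}" using G(3) by (auto simp: graph_diameter_def bot_ereal_def)
    then have n: "n \<ge> 1" using G pair_fin_digraph.pair_finite_verts[of G]
      by (metis One_nat_def Suc_leI card_gt_0_iff pair_graph_def pair_digraph_def)
    have "real (cop_number G) \<le> real n powr 1"
      using pair_graph.cop_number_le_card[OF G(1)] G(2) by simp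
    also have "\<dots> \<le> real n powr x" using n x by (intro powr_mono) auto
    finally show ?thesis .
  qed
  have ceil: "real_of_int \<lceil>log 2 (real d)\<rceil> = real (nat \<lceil>log 2 (real d)\<rceil>)"
    "nat \<lceil>log 2 (real d)\<rceil> \<ge> 2" if "d \<ge> 3" for d :: nat
  proof -
    have "log 2 (real d) > log 2 2" using that by (subst log_less_cancel_iff) auto
    then have "\<lceil>log 2 (real d)\<rceil> \<ge> 2" by (simp add: le_ceiling_iff)
    then show "real_of_int \<lceil>log 2 (real d)\<rceil> = real (nat \<lceil>log 2 (real d)\<rceil>)"
      "nat \<lceil>log 2 (real d)\<rceil> \<ge> 2" by linarith+
  qed
  have "P n 1" for n
    unfolding P_def
  proof (intro allI impI)
    fix G :: "'a pair_pre_digraph" and d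
    assume *: "pair_graph G" "card (pverts G) = n" "graph_diameter G = ereal (real d)" "3 \<le> d"
    show "real (cop_number G) \<le> real n powr (1 - 2 / (2 * real_of_int \<lceil>log 2 (real d)\<rceil> + 1) + 1)"
      using ceil[OF *(4)] by (intro trivial[OF *(1-3)]) (simp add: divide_le_eq)
  qed
  moreover have "\<forall>\<^sub>F n in sequentially. P n \<delta>" if \<delta>: "\<delta> > 0" for \<delta>
  proof -
    define \<theta> where "\<theta> L = 2 / (2 * real L + 1)" for L
    \<comment> \<open>Uniformity in \<open>d\<close>: for \<open>L \<ge> l\<close> the saving
      \<open>2 / (2 * L + 1)\<close> is at most \<open>\<delta>\<close> and the trivial bound
      suffices, so only finitely many \<open>L\<close> remain.\<close>
    obtain l :: nat where l: "1 / \<delta> < real l" using reals_Archimedean2 by blast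
    define Q where "Q L n \<longleftrightarrow> (\<forall>G :: 'a pair_pre_digraph. pair_graph G \<longrightarrow> card (pverts G) = n \<longrightarrow>
      (\<forall>u\<in>pverts G. \<forall>v\<in>pverts G. (legal_move G ^^ (2 ^ L)) u v) \<longrightarrow>
      real (cop_number G) \<le> real n powr (1 - \<theta> L + min \<delta> (\<theta> L)))" for L n
    have "\<forall>\<^sub>F n in sequentially. Q L n" if "L \<in> {2..<l}" for L
      using that \<delta> unfolding Q_def \<theta>_def by (intro cop_number_le_powr_eventually) auto
    then have "\<forall>\<^sub>F n in sequentially. \<forall>L\<in>{2..<l}. Q L n"
      by (intro eventually_ball_finite) auto
    then show ?thesis
      using eventually_ge_at_top[of 1]
    proof eventually_elim
      case (elim n)
      show ?case
        unfolding P_def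
      proof (intro allI impI)
        fix G :: "'a pair_pre_digraph" and d
        assume *: "pair_graph G" "card (pverts G) = n" "graph_diameter G = ereal (real d)" "3 \<le> d"
        define L where "L = nat \<lceil>log 2 (real d)\<rceil>"
        have L: "real_of_int \<lceil>log 2 (real d)\<rceil> = real L" "L \<ge> 2" using ceil[OF *(4)] by (auto simp: L_def)
        show "real (cop_number G) \<le> real n powr (1 - 2 / (2 * real_of_int \<lceil>log 2 (real d)\<rceil> + 1) + \<delta>)"
        proof (cases "L < l")
          case True
          have "\<forall>u\<in>pverts G. \<forall>v\<in>pverts G. (legal_move G ^^ (2 ^ L)) u v"
            using pair_graph.legal_moves_diameter[OF *(1,3)] le_two_power_ceiling_log[of d] *(4)
            by (auto simp: L_def intro: legal_moves_mono)
          then have "real (cop_number G) \<le> real n powr (1 - \<theta> L + min \<delta> (\<theta> L))"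
            using elim(1) True L(2) *(1,2) unfolding Q_def by auto
          also have "\<dots> \<le> real n powr (1 - \<theta> L + \<delta>)" using elim(2) by (intro powr_mono) auto
          finally show ?thesis by (simp add: L(1) \<theta>_def)
        next
          case False
          then have "\<delta> * real l \<le> \<delta> * real L" using \<delta> by (intro mult_left_mono) auto
          moreover have "1 < \<delta> * real l" using l \<delta> by (simp add: divide_less_eq mult.commute)
          moreover have "\<delta> * (2 * real L + 1) = 2 * (\<delta> * real L) + \<delta>" by (simp add: algebra_simps)
          ultimately have "2 \<le> \<delta> * (2 * real L + 1)" using \<delta> by linarith
          then have "2 / (2 * real L + 1) \<le> \<delta>" by (simp add: divide_le_eq)
          then show ?thesis by (intro trivial[OF *(1-3)]) (simp add: L(1))
        qed
      qed
    qed
  qed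
  ultimately obtain \<epsilon> where "\<epsilon> \<longlonglongrightarrow> 0" "\<forall>n. P n (\<epsilon> n)"
    using tendsto_zero_diagonal[of P] by metis
  then show ?thesis unfolding P_def by blast
qed

end
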